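(* Let $V$ be a countably infinite set, let $k:V\times V\to\mathbb{C}$ (or $\mathbb{R}$) be positive definite with reproducing kernel Hilbert space $\mathscr{H}=\mathscr{H}(k)$, and assume $\delta_x\in\mathscr{H}$ for all $x\in V$. Let $A:l^2(V)\to\mathscr{H}$ be the densely defined operator with domain $\mathrm{span}\{\delta_x:x\in V\}$ and $A\delta_x=\delta_x\in\mathscr{H}$. Then the following two conditions are equivalent: (i) $\delta_x\in\mathrm{dom}(A^*\overline{A})$ for all $x\in V$; (ii) for all $x\in V$ the function $y\mapsto\langle\delta_x,\delta_y\rangle_{\mathscr{H}}$ belongs to $l^2(V)$, i.e. $\sum_{y\in V}|\langle\delta_x,\delta_y\rangle_{\mathscr{H}}|^2<\infty$ for all $x\in V$.
   Context: Inner products are conjugate linear in the first variable. Positive definite means $\sum_{(x,y)\in F\times F}k(x,y)\overline{c_x}c_y\ge 0$ for all finite $F\subset V$ and all complex $c_x$. Write $k_x:=k(\cdot,x)$; $\mathscr{H}(k)$ is the Hilbert space of functions on $V$ obtained by completing $\mathrm{span}\{k_x\}$ with $\langle k_x,k_y\rangle_{\mathscr{H}}=k(x,y)$, and $\langle k_x,f\rangle_{\mathscr{H}}=f(x)$ for $f\in\mathscr{H}$. $\delta_x$ is the function equal to $1$ at $x$ and $0$ elsewhere, viewed as an element of $l^2(V)$ or of $\mathscr{H}$. The operator $A$ is closable; $\overline{A}$ is its closure and $A^*$ its adjoint. *)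

theory Defs
  imports "HOL-Analysis.Analysis"
begin

text \<open>
  The index set V is the type \<open>'v\<close>. The scalar field is a parameter \<open>K\<close>, a set of complex numbers
  which is either \<open>\<real>\<close> or \<open>UNIV\<close>; this treats the real and the complex case at once, a real Hilbert
  space of functions being a space of functions with values in \<open>\<real> \<subseteq> \<complex>\<close>.
  Inner products are conjugate linear in the first variable.
\<close>

record 'v fun_space =
  elems :: "('v \<Rightarrow> complex) set"
  ip :: "('v \<Rightarrow> complex) \<Rightarrow> ('v \<Rightarrow> complex) \<Rightarrow> complex"

definition ip_norm :: "'v fun_space \<Rightarrow> ('v \<Rightarrow> complex) \<Rightarrow> real" where
  "ip_norm S f = sqrt (Re (ip S f f))"

definition converges_in :: "'v fun_space \<Rightarrow> (nat \<Rightarrow> 'v \<Rightarrow> complex) \<Rightarrow> ('v \<Rightarrow> complex) \<Rightarrow> bool" where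
  "converges_in S u f \<longleftrightarrow> (\<forall>n. u n \<in> elems S) \<and> f \<in> elems S \<and>
     (\<lambda>n. ip_norm S (\<lambda>x. u n x - f x)) \<longlonglongrightarrow> 0"

definition cauchy_in :: "'v fun_space \<Rightarrow> (nat \<Rightarrow> 'v \<Rightarrow> complex) \<Rightarrow> bool" where
  "cauchy_in S u \<longleftrightarrow> (\<forall>n. u n \<in> elems S) \<and>
     (\<forall>e>0. \<exists>N. \<forall>m\<ge>N. \<forall>n\<ge>N. ip_norm S (\<lambda>x. u m x - u n x) < e)"

definition lincomb :: "('i \<Rightarrow> complex) \<Rightarrow> 'i set \<Rightarrow> ('i \<Rightarrow> 'v \<Rightarrow> complex) \<Rightarrow> 'v \<Rightarrow> complex" where
  "lincomb c F e = (\<lambda>x. \<Sum>i\<in>F. c i * e i x)"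

definition delta :: "'v \<Rightarrow> 'v \<Rightarrow> complex" where
  "delta x = (\<lambda>y. if y = x then 1 else 0)"

definition ell2 :: "complex set \<Rightarrow> 'v fun_space" where
  "ell2 K = \<lparr> elems = {f. range f \<subseteq> K \<and> (\<lambda>x. (cmod (f x))\<^sup>2) summable_on UNIV},
              ip = (\<lambda>f g. \<Sum>\<^sub>\<infinity>x. cnj (f x) * g x) \<rparr>"

definition pos_def_kernel :: "('v \<Rightarrow> 'v \<Rightarrow> complex) \<Rightarrow> bool" where
  "pos_def_kernel k \<longleftrightarrow>
     (\<forall>F c. finite F \<longrightarrow> (\<Sum>(x,y)\<in>F \<times> F. k x y * cnj (c x) * c y) \<in> \<real>\<^sub>\<ge>\<^sub>0)"

definition ksec :: "('v \<Rightarrow> 'v \<Rightarrow> complex) \<Rightarrow> 'v \<Rightarrow> 'v \<Rightarrow> complex" where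
  "ksec k x = (\<lambda>y. k y x)"

text \<open>The span of the kernel sections; the inner product is the sesquilinear extension of
  \<open>\<langle>k\<^sub>x, k\<^sub>y\<rangle> = k x y\<close>. Its value does not depend on the chosen representations, see
  \<open>pd_kernel.rk_span_ip\<close> below.\<close>

definition rk_span :: "complex set \<Rightarrow> ('v \<Rightarrow> 'v \<Rightarrow> complex) \<Rightarrow> 'v fun_space" where
  "rk_span K k = \<lparr>
     elems = {lincomb c F (ksec k) | c F. finite F \<and> c ` F \<subseteq> K},
     ip = (\<lambda>f g. THE z. \<exists>c F d G. finite F \<and> c ` F \<subseteq> K \<and> finite G \<and> d ` G \<subseteq> K \<and>
             f = lincomb c F (ksec k) \<and> g = lincomb d G (ksec k) \<and>
             z = (\<Sum>x\<in>F. \<Sum>y\<in>G. cnj (c x) * d y * k x y)) \<rparr>"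

text \<open>Completion of a pre-Hilbert space of functions, realised by functions: a Cauchy sequence is
  identified with its pointwise limit. The inner product is the limit of the inner products along
  approximating Cauchy sequences; for kernel spans this is well defined, see \<open>pd_kernel.rkhs_ip\<close> below.\<close>

definition approximates :: "'v fun_space \<Rightarrow> (nat \<Rightarrow> 'v \<Rightarrow> complex) \<Rightarrow> ('v \<Rightarrow> complex) \<Rightarrow> bool" where
  "approximates S u f \<longleftrightarrow> cauchy_in S u \<and> (\<forall>x. (\<lambda>n. u n x) \<longlonglongrightarrow> f x)"

definition fun_completion :: "'v fun_space \<Rightarrow> 'v fun_space" where
  "fun_completion S = \<lparr>
     elems = {f. \<exists>u. approximates S u f},
     ip = (\<lambda>f g. THE z. \<exists>u v. approximates S u f \<and> approximates S v g \<and>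
             (\<lambda>n. ip S (u n) (v n)) \<longlonglongrightarrow> z) \<rparr>"

definition rkhs :: "complex set \<Rightarrow> ('v \<Rightarrow> 'v \<Rightarrow> complex) \<Rightarrow> 'v fun_space" where
  "rkhs K k = fun_completion (rk_span K k)"

text \<open>Unbounded operators are represented by their graphs, so that the domain is \<^const>\<open>Domain\<close> and
  first applying \<open>A\<close> and then \<open>B\<close> is the relation \<open>A O B\<close>, i.e. the operator \<open>B A\<close> on its natural
  domain. For a closable operator the closure of the graph is the graph of the closure; for a
  densely defined operator the adjoint relation is the graph of the adjoint.\<close>

type_synonym 'v graph = "(('v \<Rightarrow> complex) \<times> ('v \<Rightarrow> complex)) set"

definition op_closure :: "'v fun_space \<Rightarrow> 'v fun_space \<Rightarrow> 'v graph \<Rightarrow> 'v graph" where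
  "op_closure S T A = {(f, g). \<exists>u v. (\<forall>n. (u n, v n) \<in> A) \<and>
     converges_in S u f \<and> converges_in T v g}"

definition op_adjoint :: "'v fun_space \<Rightarrow> 'v fun_space \<Rightarrow> 'v graph \<Rightarrow> 'v graph" where
  "op_adjoint S T A = {(g, h). g \<in> elems T \<and> h \<in> elems S \<and>
     (\<forall>(f, f') \<in> A. ip T f' g = ip S f h)}"

text \<open>The linear operator with domain the span of the \<open>\<delta>\<^sub>x\<close> and \<open>\<delta>\<^sub>x \<mapsto> \<delta>\<^sub>x\<close>.\<close>

definition delta_op :: "complex set \<Rightarrow> 'v graph" where
  "delta_op K = {(lincomb c F delta, lincomb c F delta) | c F. finite F \<and> c ` F \<subseteq> K}"

text \<open>Well-definedness of the inner products of \<^const>\<open>rk_span\<close> and \<^const>\<open>rkhs\<close>, and the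
  reproducing property (\<open>rkhs_reproducing\<close>).\<close>

locale pd_kernel =
  fixes K :: "complex set" and k :: "'v \<Rightarrow> 'v \<Rightarrow> complex"
  assumes scalars: "K = \<real> \<or> K = UNIV"
    and k_in: "k x y \<in> K" and pd: "pos_def_kernel k"
begin

abbreviation "S0 \<equiv> rk_span K k"

lemma K_closed: "a \<in> K \<Longrightarrow> b \<in> K \<Longrightarrow> a + b \<in> K" "a \<in> K \<Longrightarrow> b \<in> K \<Longrightarrow> a * b \<in> K"
  "a \<in> K \<Longrightarrow> cnj a \<in> K" "0 \<in> K" "1 \<in> K" "a \<in> K \<Longrightarrow> - a \<in> K"
  using scalars by (auto simp: complex_is_Real_iff)

lemma pd_sum: assumes "finite F"
  shows "(\<Sum>x\<in>F. \<Sum>y\<in>F. k x y * cnj (c x) * c y) \<in> \<real>\<^sub>\<ge>\<^sub>0"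
  using pd assms unfolding pos_def_kernel_def by (simp add: sum.cartesian_product)

lemma hermitian: "k y x = cnj (k x y)"
proof -
  have d: "Im (k z z) = 0" for z
    using pd_sum[of "{z}" "\<lambda>_. 1"] by (simp add: complex_nonneg_Reals_iff)
  show ?thesis
  proof (cases "x = y")
    case True
    then show ?thesis using d by (simp add: complex_eq_iff)
  next
    case False
    have 1: "Im (k x y) + Im (k y x) = 0"
      using pd_sum[of "{x,y}" "\<lambda>_. 1"] False d[of x] d[of y]
      by (simp add: complex_nonneg_Reals_iff)
    have 2: "Re (k x y) - Re (k y x) = 0"
      using pd_sum[of "{x,y}" "\<lambda>z. if z = x then 1 else \<i>"] False d[of x] d[of y]
      by (simp add: complex_nonneg_Reals_iff)
    show ?thesis using 1 2 by (simp add: complex_eq_iff)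
  qed
qed

lemma rk_span_ip:
  assumes "finite F" "c ` F \<subseteq> K" "finite G" "d ` G \<subseteq> K"
  shows "ip S0 (lincomb c F (ksec k)) (lincomb d G (ksec k)) =
           (\<Sum>x\<in>F. \<Sum>y\<in>G. cnj (c x) * d y * k x y)"
proof -
  have l: "(\<Sum>x\<in>F. \<Sum>y\<in>G. cnj (c x) * d y * k x y) =
     (\<Sum>x\<in>F. cnj (c x) * lincomb d G (ksec k) x)" for c d F G
    by (simp add: lincomb_def ksec_def sum_distrib_left mult_ac)
  have r: "(\<Sum>x\<in>F. \<Sum>y\<in>G. cnj (c x) * d y * k x y) =
     (\<Sum>y\<in>G. d y * cnj (lincomb c F (ksec k) y))" for c d F G
    by (subst sum.swap) (simp add: lincomb_def ksec_def sum_distrib_left mult_ac hermitian[symmetric])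
  have "(THE z. \<exists>c' F' d' G'. finite F' \<and> c' ` F' \<subseteq> K \<and> finite G' \<and> d' ` G' \<subseteq> K \<and>
     lincomb c F (ksec k) = lincomb c' F' (ksec k) \<and> lincomb d G (ksec k) = lincomb d' G' (ksec k) \<and>
     z = (\<Sum>x\<in>F'. \<Sum>y\<in>G'. cnj (c' x) * d' y * k x y)) =
     (\<Sum>x\<in>F. \<Sum>y\<in>G. cnj (c x) * d y * k x y)"
  proof (rule the_equality, goal_cases)
    case 1 show ?case using assms by blast
  next
    case (2 z)
    then obtain c' F' d' G' where
      e: "lincomb c F (ksec k) = lincomb c' F' (ksec k)" "lincomb d G (ksec k) = lincomb d' G' (ksec k)"
      and z: "z = (\<Sum>x\<in>F'. \<Sum>y\<in>G'. cnj (c' x) * d' y * k x y)" by blast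
    have "z = (\<Sum>x\<in>F'. \<Sum>y\<in>G. cnj (c' x) * d y * k x y)"
      unfolding z l e(2) ..
    also have "\<dots> = (\<Sum>x\<in>F. \<Sum>y\<in>G. cnj (c x) * d y * k x y)"
      unfolding r e(1) ..
    finally show ?case .
  qed
  then show ?thesis by (simp add: rk_span_def)
qed

lemma S0_I: "finite F \<Longrightarrow> c ` F \<subseteq> K \<Longrightarrow> lincomb c F (ksec k) \<in> elems S0"
  by (auto simp: rk_span_def)

lemma S0_E: assumes "f \<in> elems S0"
  obtains c F where "finite F" "c ` F \<subseteq> K" "f = lincomb c F (ksec k)"
  using assms by (auto simp: rk_span_def)

lemma ip0_left: assumes "finite F" "c ` F \<subseteq> K" "g \<in> elems S0"
  shows "ip S0 (lincomb c F (ksec k)) g = (\<Sum>x\<in>F. cnj (c x) * g x)"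
proof -
  obtain d G where g: "finite G" "d ` G \<subseteq> K" "g = lincomb d G (ksec k)" using assms(3) by (rule S0_E)
  have "ip S0 (lincomb c F (ksec k)) g = (\<Sum>x\<in>F. \<Sum>y\<in>G. cnj (c x) * d y * k x y)"
    unfolding g(3) by (rule rk_span_ip[OF assms(1,2) g(1,2)])
  also have "\<dots> = (\<Sum>x\<in>F. cnj (c x) * g x)"
    by (simp add: g(3) lincomb_def ksec_def sum_distrib_left mult_ac)
  finally show ?thesis .
qed

lemma ip0_right: assumes "finite F" "c ` F \<subseteq> K" "g \<in> elems S0"
  shows "ip S0 g (lincomb c F (ksec k)) = (\<Sum>x\<in>F. c x * cnj (g x))"
proof -
  obtain d G where g: "finite G" "d ` G \<subseteq> K" "g = lincomb d G (ksec k)" using assms(3) by (rule S0_E)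
  have "ip S0 g (lincomb c F (ksec k)) = (\<Sum>x\<in>G. \<Sum>y\<in>F. cnj (d x) * c y * k x y)"
    unfolding g(3) by (rule rk_span_ip[OF g(1,2) assms(1,2)])
  also have "\<dots> = (\<Sum>x\<in>F. c x * cnj (g x))"
    by (subst sum.swap) (simp add: g(3) lincomb_def ksec_def sum_distrib_left mult_ac hermitian[symmetric])
  finally show ?thesis .
qed

lemma lincomb_ext: assumes "finite G" "F \<subseteq> G"
  shows "lincomb c F e = lincomb (\<lambda>x. if x \<in> F then c x else 0) G e"
  unfolding lincomb_def using assms
  by (intro ext sum.mono_neutral_cong_left) auto

lemma S0_comb: assumes "f \<in> elems S0" "g \<in> elems S0" "a \<in> K" "b \<in> K"
  shows "(\<lambda>x. a * f x + b * g x) \<in> elems S0"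
proof -
  obtain c F where f: "finite F" "c ` F \<subseteq> K" "f = lincomb c F (ksec k)" using assms(1) by (rule S0_E)
  obtain d G where g: "finite G" "d ` G \<subseteq> K" "g = lincomb d G (ksec k)" using assms(2) by (rule S0_E)
  define c' where "c' = (\<lambda>x. if x \<in> F then c x else 0)"
  define d' where "d' = (\<lambda>x. if x \<in> G then d x else 0)"
  have f': "f = lincomb c' (F \<union> G) (ksec k)" unfolding f(3) c'_def using f g by (intro lincomb_ext) auto
  have g': "g = lincomb d' (F \<union> G) (ksec k)" unfolding g(3) d'_def using f g by (intro lincomb_ext) auto
  have "(\<lambda>x. a * f x + b * g x) = lincomb (\<lambda>x. a * c' x + b * d' x) (F \<union> G) (ksec k)"
    unfolding f' g' by (auto simp: lincomb_def sum_distrib_left sum.distrib algebra_simps)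
  also have "\<dots> \<in> elems S0"
    using f g assms by (intro S0_I) (auto simp: c'_def d'_def K_closed image_subset_iff)
  finally show ?thesis .
qed

lemma S0_diff: assumes "f \<in> elems S0" "g \<in> elems S0"
  shows "(\<lambda>x. f x - g x) \<in> elems S0"
  using S0_comb[OF assms, of 1 "-1"] K_closed(5,6) by simp

lemma ip0_lin: assumes "h \<in> elems S0" "f \<in> elems S0" "g \<in> elems S0" "a \<in> K" "b \<in> K"
  shows "ip S0 h (\<lambda>x. a * f x + b * g x) = a * ip S0 h f + b * ip S0 h g"
  using assms(1) S0_comb[OF assms(2-)] assms(2,3)
  by (elim S0_E[of h]) (simp add: ip0_left sum.distrib sum_distrib_left algebra_simps)

lemma ip0_cnj: assumes "f \<in> elems S0" "g \<in> elems S0"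
  shows "ip S0 g f = cnj (ip S0 f g)"
  using assms by (elim S0_E[of f]) (simp add: ip0_left ip0_right)

lemma ip0_diff: assumes "h \<in> elems S0" "f \<in> elems S0" "g \<in> elems S0"
  shows "ip S0 h (\<lambda>x. f x - g x) = ip S0 h f - ip S0 h g"
    "ip S0 (\<lambda>x. f x - g x) h = ip S0 f h - ip S0 g h"
proof -
  show 1: "ip S0 h (\<lambda>x. f x - g x) = ip S0 h f - ip S0 h g"
    using ip0_lin[OF assms, of 1 "-1"] K_closed(5,6) by simp
  have "ip S0 (\<lambda>x. f x - g x) h = cnj (ip S0 h (\<lambda>x. f x - g x))"
    by (rule ip0_cnj[OF assms(1) S0_diff[OF assms(2,3)]])
  also have "\<dots> = cnj (ip S0 h f) - cnj (ip S0 h g)" unfolding 1 by simp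
  also have "\<dots> = ip S0 f h - ip S0 g h"
    by (simp only: ip0_cnj[OF assms(1,2)] ip0_cnj[OF assms(1,3)])
  finally show "ip S0 (\<lambda>x. f x - g x) h = ip S0 f h - ip S0 g h" .
qed

lemma ip0_pos: assumes "f \<in> elems S0" shows "Re (ip S0 f f) \<ge> 0"
proof -
  obtain c F where f: "finite F" "c ` F \<subseteq> K" "f = lincomb c F (ksec k)" using assms by (rule S0_E)
  have "ip S0 f f = (\<Sum>(x,y)\<in>F \<times> F. k x y * cnj (c x) * c y)"
    unfolding f(3) using f by (simp add: rk_span_ip sum.cartesian_product mult_ac)
  then show ?thesis using pd f(1) by (auto simp: pos_def_kernel_def complex_nonneg_Reals_iff)
qed

lemma ip0_real: assumes "f \<in> elems S0" shows "ip S0 f f = of_real ((ip_norm S0 f)\<^sup>2)"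
proof -
  have "Im (ip S0 f f) = - Im (ip S0 f f)"
    using arg_cong[OF ip0_cnj[OF assms assms], of Im] by (metis cnj.sel(2))
  then show ?thesis using ip0_pos[OF assms] by (simp add: ip_norm_def complex_eq_iff)
qed

lemma ip0_in_K: assumes "f \<in> elems S0" "g \<in> elems S0" shows "ip S0 f g \<in> K"
proof -
  have gK: "g x \<in> K" for x using assms(2)
    by (elim S0_E) (use scalars k_in in \<open>auto simp: lincomb_def ksec_def image_subset_iff intro!: sum_in_Reals Reals_mult\<close>)
  show ?thesis using assms(1)
    by (elim S0_E) (use scalars gK assms(2) in \<open>auto simp: ip0_left image_subset_iff complex_is_Real_iff intro!: sum_in_Reals Reals_mult\<close>)
qed

lemma ip0_CS: assumes f: "f \<in> elems S0" and g: "g \<in> elems S0"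
  shows "cmod (ip S0 f g) \<le> ip_norm S0 f * ip_norm S0 g"
proof -
  define z where "z = ip S0 f g"
  define A where "A = (ip_norm S0 f)\<^sup>2"
  define B where "B = (ip_norm S0 g)\<^sup>2"
  have zK: "z \<in> K" using ip0_in_K f g by (simp add: z_def)
  have ipx: "0 \<le> A - 2 * t * (cmod z)\<^sup>2 + t\<^sup>2 * (cmod z)\<^sup>2 * B" for t :: real
  proof -
    define b where "b = - of_real t * cnj z"
    have tK: "of_real t \<in> K" using scalars by auto
    have bK: "b \<in> K" unfolding b_def using zK tK K_closed by (metis mult_minus_left)
    define h where "h = (\<lambda>x. 1 * f x + b * g x)"
    have h: "h \<in> elems S0" unfolding h_def using S0_comb f g bK K_closed by blast
    have hf: "ip S0 h f = cnj (ip S0 f h)" "ip S0 h g = cnj (ip S0 g h)" by (fact ip0_cnj[OF f h], fact ip0_cnj[OF g h])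
    have fh: "ip S0 f h = ip S0 f f + b * z" unfolding h_def z_def
      using ip0_lin[OF f f g, of 1 b] bK K_closed by simp
    have gh: "ip S0 g h = cnj z + b * ip S0 g g" unfolding h_def z_def
      using ip0_lin[OF g f g, of 1 b] bK K_closed ip0_cnj[OF f g] by simp
    have "ip S0 h h = ip S0 h f + b * ip S0 h g"
      using ip0_lin[OF h f g, of 1 b] bK K_closed(5) unfolding h_def[symmetric] by simp
    also have "\<dots> = of_real A + cnj b * cnj z + b * (z + cnj b * of_real B)"
      unfolding hf fh gh ip0_real[OF f] ip0_real[OF g] A_def B_def by simp
    also have "Re \<dots> = A - 2 * t * (cmod z)\<^sup>2 + t\<^sup>2 * (cmod z)\<^sup>2 * B"
      by (simp only: b_def cmod_power2) (simp add: power2_eq_square algebra_simps)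
    finally show ?thesis using ip0_pos[OF h] by simp
  qed
  have AB: "A \<ge> 0" "B \<ge> 0" by (auto simp: A_def B_def)
  have "(cmod z)\<^sup>2 \<le> A * B"
  proof (cases "B = 0")
    case True
    have "cmod z = 0"
    proof (rule ccontr)
      assume "cmod z \<noteq> 0"
      then have "2 * ((A + 1) / (cmod z)\<^sup>2) * (cmod z)\<^sup>2 = 2 * (A + 1)" by simp
      then show False using ipx[of "(A + 1) / (cmod z)\<^sup>2"] True AB by simp
    qed
    then show ?thesis using AB by simp
  next
    case False
    then have B: "B > 0" using AB by simp
    show ?thesis using ipx[of "1 / B"] B by (simp add: field_simps power2_eq_square)
  qed
  then have "(cmod z)\<^sup>2 \<le> (ip_norm S0 f * ip_norm S0 g)\<^sup>2" by (simp add: A_def B_def power_mult_distrib)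
  moreover have "0 \<le> ip_norm S0 f * ip_norm S0 g" using ip0_pos f g by (simp add: ip_norm_def)
  ultimately show ?thesis unfolding z_def by (meson power2_le_imp_le)
qed

lemma norm0_nn: "f \<in> elems S0 \<Longrightarrow> 0 \<le> ip_norm S0 f"
  using ip0_pos by (simp add: ip_norm_def)

lemma norm0_triangle: assumes "f \<in> elems S0" "g \<in> elems S0"
  shows "ip_norm S0 f \<le> ip_norm S0 (\<lambda>x. f x - g x) + ip_norm S0 g"
proof -
  let ?d = "\<lambda>x. f x - g x"
  have d: "?d \<in> elems S0" using S0_diff assms by blast
  have "ip S0 f f = ip S0 ?d f + ip S0 g f"
    using ip0_diff(2)[OF assms(1) assms(1,2)] by simp
  then have "(ip_norm S0 f)\<^sup>2 \<le> cmod (ip S0 ?d f) + cmod (ip S0 g f)"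
    using ip0_real[OF assms(1)] norm_triangle_ineq[of "ip S0 ?d f" "ip S0 g f"]
    by (metis norm_of_real abs_power2)
  also have "\<dots> \<le> (ip_norm S0 ?d + ip_norm S0 g) * ip_norm S0 f"
    using ip0_CS[OF d assms(1)] ip0_CS[OF assms(2,1)] by (simp add: algebra_simps)
  finally have *: "ip_norm S0 f * ip_norm S0 f \<le> (ip_norm S0 ?d + ip_norm S0 g) * ip_norm S0 f"
    by (simp add: power2_eq_square)
  show ?thesis
  proof (cases "ip_norm S0 f = 0")
    case True then show ?thesis using norm0_nn d assms by simp
  next
    case False
    then have "ip_norm S0 f > 0" using norm0_nn assms by (simp add: less_le)
    then show ?thesis using * by simp
  qed
qed

lemma cauchy_D: assumes "cauchy_in S0 u" "e > 0"
  shows "\<exists>N. \<forall>m\<ge>N. \<forall>n\<ge>N. ip_norm S0 (\<lambda>x. u m x - u n x) < e"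
  using assms unfolding cauchy_in_def by simp

lemma ip0_diff_bound:
  assumes a: "a \<in> elems S0" "a' \<in> elems S0" and b: "b \<in> elems S0" "b' \<in> elems S0"
    and C: "ip_norm S0 b \<le> C" and D: "ip_norm S0 a' \<le> D"
  shows "cmod (ip S0 a b - ip S0 a' b') \<le>
     ip_norm S0 (\<lambda>x. a x - a' x) * C + D * ip_norm S0 (\<lambda>x. b x - b' x)"
proof -
  have da: "(\<lambda>x. a x - a' x) \<in> elems S0" and db: "(\<lambda>x. b x - b' x) \<in> elems S0"
    by (rule S0_diff[OF a], rule S0_diff[OF b])
  have "ip S0 a b - ip S0 a' b' = ip S0 (\<lambda>x. a x - a' x) b + ip S0 a' (\<lambda>x. b x - b' x)"
    unfolding ip0_diff(2)[OF b(1) a] ip0_diff(1)[OF a(2) b] by simp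
  then have "cmod (ip S0 a b - ip S0 a' b') \<le>
      cmod (ip S0 (\<lambda>x. a x - a' x) b) + cmod (ip S0 a' (\<lambda>x. b x - b' x))"
    using norm_triangle_ineq by simp
  also have "\<dots> \<le> ip_norm S0 (\<lambda>x. a x - a' x) * C + D * ip_norm S0 (\<lambda>x. b x - b' x)"
    using ip0_CS[OF da b(1)] ip0_CS[OF a(2) db]
      mult_left_mono[OF C norm0_nn[OF da]] mult_right_mono[OF D norm0_nn[OF db]] by linarith
  finally show ?thesis .
qed

lemma cauchy_bdd: assumes "cauchy_in S0 u"
  shows "\<exists>C>0. \<forall>n. ip_norm S0 (u n) \<le> C"
proof -
  have "(1::real) > 0" by simp
    from cauchy_D[OF assms this] obtain N where N0: "\<forall>m\<ge>N. \<forall>n\<ge>N. ip_norm S0 (\<lambda>x. u m x - u n x) < 1" ..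
    note N = N0[rule_format]
  have u: "u n \<in> elems S0" for n using assms by (simp add: cauchy_in_def)
  define C where "C = 1 + ip_norm S0 (u N) + (\<Sum>n\<le>N. ip_norm S0 (u n))"
  have "ip_norm S0 (u n) \<le> C" for n
  proof (cases "n \<le> N")
    case True
    have "ip_norm S0 (u n) \<le> (\<Sum>n\<le>N. ip_norm S0 (u n))"
      using True u norm0_nn by (intro member_le_sum) auto
    then show ?thesis using norm0_nn[OF u[of N]] by (simp add: C_def)
  next
    case False
    then have "ip_norm S0 (\<lambda>x. u n x - u N x) < 1" using N by simp
    moreover have "0 \<le> (\<Sum>n\<le>N. ip_norm S0 (u n))" by (intro sum_nonneg norm0_nn u)
    ultimately show ?thesis using norm0_triangle[OF u[of n] u[of N]] by (simp add: C_def)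
  qed
  moreover have "C > 0" using norm0_nn u unfolding C_def by (smt (verit) sum_nonneg)
  ultimately show ?thesis by blast
qed

lemma ip0_convergent: assumes "cauchy_in S0 u" "cauchy_in S0 v"
  shows "convergent (\<lambda>n. ip S0 (u n) (v n))"
proof (rule Cauchy_convergent, rule CauchyI)
  fix e :: real assume e: "e > 0"
  obtain C where C: "C > 0" "\<And>n. ip_norm S0 (u n) \<le> C" using cauchy_bdd[OF assms(1)] by blast
  obtain D where D: "D > 0" "\<And>n. ip_norm S0 (v n) \<le> D" using cauchy_bdd[OF assms(2)] by blast
  have u: "u n \<in> elems S0" and v: "v n \<in> elems S0" for n using assms by (auto simp: cauchy_in_def)
  have "e / (2 * D) > 0" by (use e D(1) in simp)
    from cauchy_D[OF assms(1) this] obtain N where N0: "\<forall>m\<ge>N. \<forall>n\<ge>N. ip_norm S0 (\<lambda>x. u m x - u n x) < e / (2 * D)" ..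
    note N = N0[rule_format]
  have "e / (2 * C) > 0" by (use e C(1) in simp)
    from cauchy_D[OF assms(2) this] obtain M where M0: "\<forall>m\<ge>M. \<forall>n\<ge>M. ip_norm S0 (\<lambda>x. v m x - v n x) < e / (2 * C)" ..
    note M = M0[rule_format]
  have "cmod (ip S0 (u m) (v m) - ip S0 (u n) (v n)) < e" if "m \<ge> max N M" "n \<ge> max N M" for m n
  proof -
    have "cmod (ip S0 (u m) (v m) - ip S0 (u n) (v n)) \<le>
        ip_norm S0 (\<lambda>x. u m x - u n x) * D + C * ip_norm S0 (\<lambda>x. v m x - v n x)"
      by (rule ip0_diff_bound[OF u u v v D(2) C(2)])
    also have "\<dots> < (e / (2 * D)) * D + C * (e / (2 * C))"
      by (intro add_strict_mono mult_strict_right_mono mult_strict_left_mono N M C(1) D(1)) (use that in auto)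
    also have "\<dots> = e" using C(1) D(1) by simp
    finally show ?thesis .
  qed
  then show "\<exists>M. \<forall>m\<ge>M. \<forall>n\<ge>M. cmod (ip S0 (u m) (v m) - ip S0 (u n) (v n)) < e" by blast
qed

lemma cauchy_diff: assumes "cauchy_in S0 u" "cauchy_in S0 v"
  shows "cauchy_in S0 (\<lambda>n x. u n x - v n x)"
proof -
  have u: "u n \<in> elems S0" and v: "v n \<in> elems S0" for n using assms by (auto simp: cauchy_in_def)
  have "\<exists>N. \<forall>m\<ge>N. \<forall>n\<ge>N. ip_norm S0 (\<lambda>x. (u m x - v m x) - (u n x - v n x)) < e" if "e > 0" for e
  proof -
    have "e / 2 > 0" by (use that in simp)
    from cauchy_D[OF assms(1) this] obtain N where N0: "\<forall>m\<ge>N. \<forall>n\<ge>N. ip_norm S0 (\<lambda>x. u m x - u n x) < e / 2" ..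
    note N = N0[rule_format]
    have "e / 2 > 0" by (use that in simp)
    from cauchy_D[OF assms(2) this] obtain M where M0: "\<forall>m\<ge>M. \<forall>n\<ge>M. ip_norm S0 (\<lambda>x. v m x - v n x) < e / 2" ..
    note M = M0[rule_format]
    have "ip_norm S0 (\<lambda>x. (u m x - v m x) - (u n x - v n x)) < e" if "m \<ge> max N M" "n \<ge> max N M" for m n
    proof -
      have e1: "(\<lambda>x. ((u m x - v m x) - (u n x - v n x)) - (v n x - v m x)) = (\<lambda>x. u m x - u n x)"
        by (simp add: algebra_simps)
      have "ip_norm S0 (\<lambda>x. (u m x - v m x) - (u n x - v n x)) \<le>
         ip_norm S0 (\<lambda>x. ((u m x - v m x) - (u n x - v n x)) - (v n x - v m x)) + ip_norm S0 (\<lambda>x. v n x - v m x)"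
        by (intro norm0_triangle S0_diff u v)
      then show ?thesis unfolding e1 using N[of m n] M[of n m] that by simp
    qed
    then show ?thesis by blast
  qed
  then show ?thesis using S0_diff[OF u v] by (simp add: cauchy_in_def)
qed

lemma null_norm: assumes "approximates S0 w (\<lambda>_. 0)"
  shows "(\<lambda>n. ip_norm S0 (w n)) \<longlonglongrightarrow> 0"
proof -
  have cw: "cauchy_in S0 w" and p: "\<And>x. (\<lambda>n. w n x) \<longlonglongrightarrow> 0"
    using assms by (auto simp: approximates_def)
  have w: "w n \<in> elems S0" for n using cw by (auto simp: cauchy_in_def)
  obtain C where C: "C > 0" "\<And>n. ip_norm S0 (w n) \<le> C" using cauchy_bdd[OF cw] by blast
  have pt: "(\<lambda>n. ip S0 (w n) g) \<longlonglongrightarrow> 0" if gS: "g \<in> elems S0" for g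
  proof -
    obtain c F where g: "finite F" "c ` F \<subseteq> K" "g = lincomb c F (ksec k)" using gS by (rule S0_E)
    have "(\<lambda>n. \<Sum>x\<in>F. c x * cnj (w n x)) \<longlonglongrightarrow> (\<Sum>x\<in>F. c x * cnj 0)"
      by (intro tendsto_intros p)
    then show ?thesis unfolding g(3) using w g by (simp add: ip0_right)
  qed
  have "(\<lambda>n. (ip_norm S0 (w n))\<^sup>2) \<longlonglongrightarrow> 0"
  proof (rule LIMSEQ_I)
    fix e :: real assume e: "e > 0"
    have "e / (2 * C) > 0" by (use e C(1) in simp)
    from cauchy_D[OF cw this] obtain N where N0: "\<forall>m\<ge>N. \<forall>n\<ge>N. ip_norm S0 (\<lambda>x. w m x - w n x) < e / (2 * C)" ..
    note N = N0[rule_format]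
    obtain M where M: "\<And>n. n \<ge> M \<Longrightarrow> cmod (ip S0 (w n) (w N)) < e / 2"
      using LIMSEQ_D[OF pt[OF w[of N]], of "e / 2"] e by auto
    have "(ip_norm S0 (w n))\<^sup>2 < e" if "n \<ge> max N M" for n
    proof -
      have "ip S0 (w n) (w n) = ip S0 (w n) (\<lambda>x. w n x - w N x) + ip S0 (w n) (w N)"
        using w by (simp add: ip0_diff)
      then have "(ip_norm S0 (w n))\<^sup>2 \<le> cmod (ip S0 (w n) (\<lambda>x. w n x - w N x)) + cmod (ip S0 (w n) (w N))"
        using ip0_real[OF w[of n]] norm_triangle_ineq by (metis norm_of_real abs_power2)
      also have "\<dots> \<le> C * ip_norm S0 (\<lambda>x. w n x - w N x) + cmod (ip S0 (w n) (w N))"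
        using ip0_CS[OF w[of n] S0_diff[OF w[of n] w[of N]]] C(2)[of n] norm0_nn[OF S0_diff[OF w[of n] w[of N]]]
        by (smt (verit) mult_right_mono)
      also have "\<dots> < C * (e / (2 * C)) + e / 2"
        using N[of n N] M[of n] that C(1) by (intro add_strict_mono mult_strict_left_mono) auto
      also have "\<dots> = e" using C(1) by simp
      finally show ?thesis .
    qed
    then show "\<exists>no. \<forall>n\<ge>no. norm ((ip_norm S0 (w n))\<^sup>2 - 0) < e"
      by (intro exI[of _ "max N M"]) simp
  qed
  then have "(\<lambda>n. sqrt ((ip_norm S0 (w n))\<^sup>2)) \<longlonglongrightarrow> sqrt 0" by (intro tendsto_intros)
  then show ?thesis using norm0_nn w by simp
qed

lemma approx_diff: assumes "approximates S0 u f" "approximates S0 v g"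
  shows "approximates S0 (\<lambda>n x. u n x - v n x) (\<lambda>x. f x - g x)"
  using assms cauchy_diff by (simp add: approximates_def tendsto_diff)

lemma rkhs_ip:
  assumes u: "approximates S0 u f" and v: "approximates S0 v g"
  shows "(\<lambda>n. ip S0 (u n) (v n)) \<longlonglongrightarrow> ip (rkhs K k) f g"
proof -
  have cu: "cauchy_in S0 u" and cv: "cauchy_in S0 v" using u v by (auto simp: approximates_def)
  obtain z where z: "(\<lambda>n. ip S0 (u n) (v n)) \<longlonglongrightarrow> z"
    using ip0_convergent[OF cu cv] by (auto simp: convergent_def)
  have "(THE z. \<exists>u v. approximates S0 u f \<and> approximates S0 v g \<and>
             (\<lambda>n. ip S0 (u n) (v n)) \<longlonglongrightarrow> z) = z"
  proof (rule the_equality, goal_cases)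
    case 1 show ?case using u v z by blast
  next
    case (2 z')
    then obtain u' v' where u': "approximates S0 u' f" and v': "approximates S0 v' g"
      and z': "(\<lambda>n. ip S0 (u' n) (v' n)) \<longlonglongrightarrow> z'" by blast
    have cu': "cauchy_in S0 u'" and cv': "cauchy_in S0 v'" using u' v' by (auto simp: approximates_def)
    obtain C where C: "C > 0" "\<And>n. ip_norm S0 (v n) \<le> C" using cauchy_bdd[OF cv] by blast
    obtain D where D: "D > 0" "\<And>n. ip_norm S0 (u' n) \<le> D" using cauchy_bdd[OF cu'] by blast
    note el = cu[unfolded cauchy_in_def, THEN conjunct1, rule_format] cv[unfolded cauchy_in_def, THEN conjunct1, rule_format]
       cu'[unfolded cauchy_in_def, THEN conjunct1, rule_format] cv'[unfolded cauchy_in_def, THEN conjunct1, rule_format]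
    have nu: "(\<lambda>n. ip_norm S0 (\<lambda>x. u n x - u' n x)) \<longlonglongrightarrow> 0"
      using null_norm approx_diff[OF u u'] by simp
    have nv: "(\<lambda>n. ip_norm S0 (\<lambda>x. v n x - v' n x)) \<longlonglongrightarrow> 0"
      using null_norm approx_diff[OF v v'] by simp
    have b: "cmod (ip S0 (u n) (v n) - ip S0 (u' n) (v' n)) \<le>
       ip_norm S0 (\<lambda>x. u n x - u' n x) * C + D * ip_norm S0 (\<lambda>x. v n x - v' n x)" for n
      by (rule ip0_diff_bound[OF el(1,3,2,4) C(2) D(2)])
    have "(\<lambda>n. ip_norm S0 (\<lambda>x. u n x - u' n x) * C + D * ip_norm S0 (\<lambda>x. v n x - v' n x)) \<longlonglongrightarrow> 0 * C + D * 0"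
      by (intro tendsto_intros nu nv)
    then have "(\<lambda>n. ip S0 (u n) (v n) - ip S0 (u' n) (v' n)) \<longlonglongrightarrow> 0"
      by (intro Lim_null_comparison[OF always_eventually[OF allI[OF b]]]) simp
    moreover have "(\<lambda>n. ip S0 (u n) (v n) - ip S0 (u' n) (v' n)) \<longlonglongrightarrow> z - z'"
      by (intro tendsto_intros z z')
    ultimately have "z - z' = 0" using LIMSEQ_unique by blast
    then show ?case by simp
  qed
  then show ?thesis using z by (simp add: rkhs_def fun_completion_def)
qed

lemma approx_const: assumes "f \<in> elems S0" shows "approximates S0 (\<lambda>_. f) f"
proof -
  have "(\<lambda>x::'v. 0) = lincomb (\<lambda>_. 0) {} (ksec k)" by (simp add: lincomb_def)
  then have "ip S0 (\<lambda>x. 0) (\<lambda>x. 0) = 0" using rk_span_ip[of "{}" "\<lambda>_. 0" "{}" "\<lambda>_. 0"] by simp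
  then have "ip_norm S0 (\<lambda>x. 0) = 0" by (simp add: ip_norm_def)
  then show ?thesis using assms by (simp add: approximates_def cauchy_in_def)
qed

lemma ksec_lincomb: "ksec k x = lincomb (\<lambda>_. 1) {x} (ksec k)"
  by (simp add: lincomb_def)

lemma ksec_S0: "ksec k x \<in> elems S0"
  by (subst ksec_lincomb) (intro S0_I, auto simp: K_closed)

lemma rkhs_reproducing:
  "ksec k x \<in> elems (rkhs K k)"
  "f \<in> elems (rkhs K k) \<Longrightarrow> ip (rkhs K k) (ksec k x) f = f x"
  "ip (rkhs K k) (ksec k x) (ksec k y) = k x y"
proof -
  have a: "ksec k x \<in> elems (rkhs K k)" for x
    using approx_const[OF ksec_S0[of x]] by (auto simp: rkhs_def fun_completion_def)
  have b: "ip (rkhs K k) (ksec k x) f = f x" if "f \<in> elems (rkhs K k)" for f x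
  proof -
    have "\<exists>u. approximates S0 u f" using that by (simp add: rkhs_def fun_completion_def)
    then obtain u where u: "approximates S0 u f" ..
    have "u n \<in> elems S0" for n using u by (auto simp: approximates_def cauchy_in_def)
    then have "ip S0 (ksec k x) (u n) = u n x" for n
      by (subst ksec_lincomb, subst ip0_left) (auto simp: K_closed)
    then have "(\<lambda>n. u n x) \<longlonglongrightarrow> ip (rkhs K k) (ksec k x) f"
      using rkhs_ip[OF approx_const[OF ksec_S0[of x]] u] by simp
    then show ?thesis using u LIMSEQ_unique by (auto simp: approximates_def)
  qed
  show "ksec k x \<in> elems (rkhs K k)" by (fact a)
  show "f \<in> elems (rkhs K k) \<Longrightarrow> ip (rkhs K k) (ksec k x) f = f x" by (fact b)
  show "ip (rkhs K k) (ksec k x) (ksec k y) = k x y" using b[OF a] by (simp add: ksec_def)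
qed

end

end

theory Submission
  imports Defs
begin

text \<open>
  Convergence in \<open>l\<^sup>2(V)\<close> and convergence in \<open>\<H>(k)\<close> both imply pointwise convergence, so the closure
  of \<open>A\<close> relates \<open>\<delta>\<^sub>x\<close> to nothing but \<open>\<delta>\<^sub>x\<close>. Hence \<open>\<delta>\<^sub>x\<close> lies in the domain of \<open>A\<^sup>*\<close> composed with the
  closure iff the functional \<open>\<delta>\<^sub>y \<mapsto> \<langle>\<delta>\<^sub>y, \<delta>\<^sub>x\<rangle>\<close> is represented by some \<open>h \<in> l\<^sup>2(V)\<close>, and testing on
  \<open>\<delta>\<^sub>y\<close> forces \<open>h(y) = \<langle>\<delta>\<^sub>y, \<delta>\<^sub>x\<rangle>\<close>.
\<close>

section \<open>Square-summable functions and the span of the \<open>delta x\<close>\<close>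

lemma ell2_elems_iff:
  "f \<in> elems (ell2 K) \<longleftrightarrow> range f \<subseteq> K \<and> (\<lambda>x. (cmod (f x))\<^sup>2) summable_on UNIV"
  by (simp add: ell2_def)

lemma infsum_finite_support:
  assumes "finite F" "\<And>x. x \<notin> F \<Longrightarrow> f x = 0"
  shows "(\<Sum>\<^sub>\<infinity>x. f x) = sum f F"
proof -
  have "(\<Sum>\<^sub>\<infinity>x. f x) = infsum f F"
    using assms(2) by (intro infsum_cong_neutral) auto
  then show ?thesis using assms(1) by simp
qed

text \<open>Comparison with \<open>2 * |f|^2 + 2 * |g|^2\<close>. It makes the pointwise bound below
  applicable to the differences occurring in \<open>converges_in\<close>.\<close>

lemma summable_on_diff_square:
  fixes f g :: "'a \<Rightarrow> complex"
  assumes "(\<lambda>x. (cmod (f x))\<^sup>2) summable_on A" "(\<lambda>x. (cmod (g x))\<^sup>2) summable_on A"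
  shows "(\<lambda>x. (cmod (f x - g x))\<^sup>2) summable_on A"
proof (rule summable_on_comparison_test)
  show "(\<lambda>x. 2 * (cmod (f x))\<^sup>2 + 2 * (cmod (g x))\<^sup>2) summable_on A"
    by (intro summable_on_add summable_on_cmult_right assms)
  fix x
  have "(cmod (f x - g x))\<^sup>2 \<le> (cmod (f x) + cmod (g x))\<^sup>2"
    by (simp add: norm_triangle_ineq4)
  also have "\<dots> \<le> 2 * (cmod (f x))\<^sup>2 + 2 * (cmod (g x))\<^sup>2"
    using sum_squares_bound[of "cmod (f x)" "cmod (g x)"] by (simp add: power2_sum)
  finally show "(cmod (f x - g x))\<^sup>2 \<le> 2 * (cmod (f x))\<^sup>2 + 2 * (cmod (g x))\<^sup>2" .
qed simp

text \<open>One term of a sum of nonnegative reals is at most the whole sum. Summability matters: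
  \<open>infsum\<close> takes the value 0 on a divergent family.\<close>

lemma cmod_le_ell2_norm:
  assumes "(\<lambda>x. (cmod (f x))\<^sup>2) summable_on UNIV"
  shows "cmod (f x) \<le> ip_norm (ell2 K) f"
proof -
  have "ip (ell2 K) f f = (\<Sum>\<^sub>\<infinity>x. of_real ((cmod (f x))\<^sup>2))"
    by (simp add: ell2_def complex_norm_square mult.commute del: of_real_power)
  also have "\<dots> = of_real (\<Sum>\<^sub>\<infinity>x. (cmod (f x))\<^sup>2)"
    by (intro infsumI has_sum_of_real has_sum_infsum assms)
  finally have e: "ip (ell2 K) f f = of_real (\<Sum>\<^sub>\<infinity>x. (cmod (f x))\<^sup>2)" .
  have "(cmod (f x))\<^sup>2 = (\<Sum>\<^sub>\<infinity>y\<in>{x}. (cmod (f y))\<^sup>2)"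
    by simp
  also have "\<dots> \<le> (\<Sum>\<^sub>\<infinity>y. (cmod (f y))\<^sup>2)"
    by (rule infsum_mono2) (use assms in auto)
  finally show ?thesis
    by (simp add: ip_norm_def e real_le_rsqrt)
qed

lemma ell2_converges_pointwise:
  assumes "converges_in (ell2 K) u f"
  shows "(\<lambda>n. u n x) \<longlonglongrightarrow> f x"
proof -
  have "cmod (u n x - f x) \<le> ip_norm (ell2 K) (\<lambda>x. u n x - f x)" for n
    using assms
    by (intro cmod_le_ell2_norm summable_on_diff_square) (auto simp: converges_in_def ell2_elems_iff)
  moreover have "(\<lambda>n. ip_norm (ell2 K) (\<lambda>x. u n x - f x)) \<longlonglongrightarrow> 0"
    using assms by (simp add: converges_in_def)
  ultimately have "(\<lambda>n. u n x - f x) \<longlonglongrightarrow> 0"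
    by (rule Lim_null_comparison[OF always_eventually[OF allI]])
  then show ?thesis by (simp add: LIM_zero_iff)
qed

lemma delta_in_ell2:
  assumes "0 \<in> K" "1 \<in> K"
  shows "delta x \<in> elems (ell2 K)"
proof -
  have "(\<lambda>y. (cmod (delta x y))\<^sup>2) summable_on UNIV"
    by (rule finite_nonzero_values_imp_summable_on, rule finite_subset[of _ "{x}"])
      (auto simp: delta_def)
  then show ?thesis using assms by (auto simp: ell2_elems_iff delta_def)
qed

lemma lincomb_delta:
  assumes "finite F"
  shows "lincomb c F delta = (\<lambda>y. if y \<in> F then c y else 0)"
proof
  fix y
  have "lincomb c F delta y = (\<Sum>i\<in>F. if y = i then c i else 0)"
    by (simp add: lincomb_def delta_def if_distrib cong: if_cong)
  then show "lincomb c F delta y = (if y \<in> F then c y else 0)"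
    using assms by simp
qed

lemma delta_eq_lincomb: "delta x = lincomb (\<lambda>_. 1) {x} delta"
  by (simp add: lincomb_def)

text \<open>The left argument vanishes off \<open>F\<close>, which makes the infinite sum finite for
  every function \<open>h\<close>.\<close>

lemma ell2_ip_lincomb_delta:
  assumes "finite F"
  shows "ip (ell2 K) (lincomb c F delta) h = (\<Sum>y\<in>F. cnj (c y) * h y)"
proof -
  have "ip (ell2 K) (lincomb c F delta) h = (\<Sum>y\<in>F. cnj (lincomb c F delta y) * h y)"
    unfolding ell2_def
    by (simp, rule infsum_finite_support[OF assms]) (simp add: lincomb_delta[OF assms])
  then show ?thesis by (simp add: lincomb_delta[OF assms])
qed

lemma delta_in_delta_op:
  assumes "1 \<in> K"
  shows "(delta x, delta x) \<in> delta_op K"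
proof -
  have "(lincomb (\<lambda>_. 1) {x} delta, lincomb (\<lambda>_. 1) {x} delta) \<in> delta_op K"
    unfolding delta_op_def using assms by blast
  then show ?thesis by (simp flip: delta_eq_lincomb)
qed

text \<open>For an arbitrary record \<open>S\<close> nothing forces the zero function to have norm
  0, hence the second hypothesis.\<close>

lemma converges_in_const:
  assumes "f \<in> elems S" "ip S (\<lambda>_. 0) (\<lambda>_. 0) = 0"
  shows "converges_in S (\<lambda>_. f) f"
  using assms by (simp add: converges_in_def ip_norm_def)

section \<open>Sesquilinearity of the inner product on the completion\<close>

context pd_kernel
begin

abbreviation "H \<equiv> rkhs K k"

lemma rkhs_elems_iff: "f \<in> elems H \<longleftrightarrow> (\<exists>u. approximates S0 u f)"
  by (simp add: rkhs_def fun_completion_def)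

lemma approximates_S0: "approximates S0 u f \<Longrightarrow> u n \<in> elems S0"
  by (simp add: approximates_def cauchy_in_def)

lemma rkhs_diff: "f \<in> elems H \<Longrightarrow> g \<in> elems H \<Longrightarrow> (\<lambda>x. f x - g x) \<in> elems H"
  unfolding rkhs_elems_iff by (elim exE) (rule exI, rule approx_diff)

lemma S0_zero: "(\<lambda>_. 0) \<in> elems S0"
  using S0_I[of "{}" "\<lambda>_. 0"] by (simp add: lincomb_def)

lemma rkhs_zero: "(\<lambda>_. 0) \<in> elems H"
  unfolding rkhs_elems_iff using approx_const[OF S0_zero] by blast

lemma S0_scale: "f \<in> elems S0 \<Longrightarrow> a \<in> K \<Longrightarrow> (\<lambda>x. a * f x) \<in> elems S0"
  using S0_comb[OF _ S0_zero, of f a 0] K_closed(4) by simp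

lemma ip0_scale:
  assumes "f \<in> elems S0" "g \<in> elems S0" "a \<in> K"
  shows "ip S0 g (\<lambda>x. a * f x) = a * ip S0 g f" "ip S0 (\<lambda>x. a * f x) g = cnj a * ip S0 f g"
proof -
  show 1: "ip S0 g (\<lambda>x. a * f x) = a * ip S0 g f"
    using ip0_lin[OF assms(2,1) S0_zero assms(3) K_closed(4)] by simp
  show "ip S0 (\<lambda>x. a * f x) g = cnj a * ip S0 f g"
    using ip0_cnj[OF assms(2) S0_scale[OF assms(1,3)]] ip0_cnj[OF assms(2,1)] 1 by simp
qed

lemma norm0_scale:
  assumes "f \<in> elems S0" "a \<in> K"
  shows "ip_norm S0 (\<lambda>x. a * f x) = cmod a * ip_norm S0 f"
proof -
  have "ip S0 (\<lambda>x. a * f x) (\<lambda>x. a * f x) = of_real ((cmod a * ip_norm S0 f)\<^sup>2)"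
    using assms S0_scale[OF assms]
    by (simp add: ip0_scale ip0_real power_mult_distrib complex_norm_square mult_ac del: of_real_power)
  then show ?thesis
    using norm0_nn[OF assms(1)] by (simp add: ip_norm_def)
qed

lemma approx_scale:
  assumes "approximates S0 u f" "a \<in> K"
  shows "approximates S0 (\<lambda>n x. a * u n x) (\<lambda>x. a * f x)"
proof -
  have u: "u n \<in> elems S0" for n by (rule approximates_S0[OF assms(1)])
  have c: "cauchy_in S0 u" using assms(1) by (simp add: approximates_def)
  have "\<exists>N. \<forall>m\<ge>N. \<forall>n\<ge>N. ip_norm S0 (\<lambda>x. a * u m x - a * u n x) < e" if e: "e > 0" for e
  proof -
    \<comment> \<open>Dividing by \<open>cmod a + 1\<close> instead of \<open>cmod a\<close> covers
      \<open>a = 0\<close>.\<close>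
    have pos: "cmod a + 1 > 0" using norm_ge_zero[of a] by linarith
    obtain N where N: "\<forall>m\<ge>N. \<forall>n\<ge>N. ip_norm S0 (\<lambda>x. u m x - u n x) < e / (cmod a + 1)"
      using cauchy_D[OF c, of "e / (cmod a + 1)"] e pos by auto
    have "ip_norm S0 (\<lambda>x. a * u m x - a * u n x) < e" if "m \<ge> N" "n \<ge> N" for m n
    proof -
      have d: "(\<lambda>x. u m x - u n x) \<in> elems S0" by (rule S0_diff[OF u u])
      have "ip_norm S0 (\<lambda>x. a * u m x - a * u n x) = cmod a * ip_norm S0 (\<lambda>x. u m x - u n x)"
        using norm0_scale[OF d assms(2)] by (simp add: right_diff_distrib)
      also have "\<dots> \<le> (cmod a + 1) * ip_norm S0 (\<lambda>x. u m x - u n x)"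
        using norm0_nn[OF d] by (simp add: mult_right_mono)
      also have "\<dots> < e"
        using N that pos by (simp add: pos_less_divide_eq mult.commute)
      finally show ?thesis .
    qed
    then show ?thesis by blast
  qed
  then show ?thesis
    using assms u by (simp add: approximates_def cauchy_in_def S0_scale tendsto_mult_left)
qed

lemma rkhs_ip_cnj:
  assumes "f \<in> elems H" "g \<in> elems H"
  shows "ip H g f = cnj (ip H f g)"
proof -
  obtain u v where u: "approximates S0 u f" and v: "approximates S0 v g"
    using assms by (auto simp: rkhs_elems_iff)
  have "(\<lambda>n. ip S0 (v n) (u n)) \<longlonglongrightarrow> cnj (ip H f g)"
    unfolding ip0_cnj[OF approximates_S0[OF u] approximates_S0[OF v]]
    by (intro tendsto_cnj rkhs_ip u v)
  then show ?thesis using rkhs_ip[OF v u] LIMSEQ_unique by blast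
qed

text \<open>Sum and scaling are treated at once because this is the induction step for finite linear
  combinations. Both claims pass to the limit from the span.\<close>

lemma rkhs_ip_add_scale_left:
  assumes "f \<in> elems H" "g \<in> elems H" "h \<in> elems H" "a \<in> K"
  shows "(\<lambda>x. f x + a * g x) \<in> elems H"
    and "ip H (\<lambda>x. f x + a * g x) h = ip H f h + cnj a * ip H g h"
proof -
  obtain u v w where u: "approximates S0 u f" and v: "approximates S0 v g" and w: "approximates S0 w h"
    using assms by (auto simp: rkhs_elems_iff)
  note el = approximates_S0[OF u] approximates_S0[OF v] approximates_S0[OF w]
  have a': "- a \<in> K" using assms(4) K_closed(6) by blast
  \<comment> \<open>Approximating sequences are known to be stable under differences, so the sum is
    written as one.\<close>
  have s: "approximates S0 (\<lambda>n x. u n x - (- a) * v n x) (\<lambda>x. f x - (- a) * g x)"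
    by (intro approx_diff approx_scale u v a')
  then show "(\<lambda>x. f x + a * g x) \<in> elems H"
    by (auto simp: rkhs_elems_iff)
  have "ip S0 (\<lambda>x. u n x - (- a) * v n x) (w n) = ip S0 (u n) (w n) + cnj a * ip S0 (v n) (w n)" for n
    by (simp only: ip0_diff(2)[OF el(3) el(1) S0_scale[OF el(2) a']] ip0_scale(2)[OF el(2,3) a']) simp
  then have "(\<lambda>n. ip S0 (\<lambda>x. u n x - (- a) * v n x) (w n)) \<longlonglongrightarrow> ip H f h + cnj a * ip H g h"
    by (simp only:) (intro tendsto_intros rkhs_ip u v w)
  with rkhs_ip[OF s w] show "ip H (\<lambda>x. f x + a * g x) h = ip H f h + cnj a * ip H g h"
    using LIMSEQ_unique by fastforce
qed

text \<open>Additivity for \<open>0 = 0 + 1 * 0\<close> gives \<open>z = z + z\<close>.\<close>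

lemma rkhs_ip_zero_left: "h \<in> elems H \<Longrightarrow> ip H (\<lambda>_. 0) h = 0"
  using rkhs_ip_add_scale_left(2)[OF rkhs_zero rkhs_zero, of h 1] K_closed(5) by simp

text \<open>Membership is proved along with the formula, since the induction step needs the shorter
  combination to lie in \<open>H\<close>.\<close>

lemma rkhs_ip_lincomb_left:
  assumes "finite F" "c ` F \<subseteq> K" "\<And>i. i \<in> F \<Longrightarrow> e i \<in> elems H" "h \<in> elems H"
  shows "lincomb c F e \<in> elems H \<and> ip H (lincomb c F e) h = (\<Sum>i\<in>F. cnj (c i) * ip H (e i) h)"
  using assms(1-3)
proof (induction F rule: finite_induct)
  case empty
  then show ?case using rkhs_zero rkhs_ip_zero_left[OF assms(4)] by (simp add: lincomb_def)
next
  case (insert i F)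
  have l: "lincomb c (insert i F) e = (\<lambda>x. lincomb c F e x + c i * e i x)"
    using insert by (simp add: lincomb_def add.commute fun_eq_iff)
  have "lincomb c F e \<in> elems H" "e i \<in> elems H" "c i \<in> K"
    using insert by auto
  from rkhs_ip_add_scale_left[OF this(1,2) assms(4) this(3)] show ?case
    unfolding l using insert by (simp add: add.commute)
qed

section \<open>Bounded point evaluations and the closure of the operator\<close>

lemma rkhs_point_bound:
  assumes "f \<in> elems H"
  shows "cmod (f x) \<le> ip_norm S0 (ksec k x) * ip_norm H f"
proof -
  obtain u where u: "approximates S0 u f" using assms by (auto simp: rkhs_elems_iff)
  \<comment> \<open>Cauchy-Schwarz is at hand on the span only. It is applied to
    \<open>ksec k x\<close> and \<open>u n\<close>, and the bound survives the limit because the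
    norms converge too.\<close>
  have n: "(\<lambda>n. ip_norm S0 (u n)) \<longlonglongrightarrow> ip_norm H f"
    unfolding ip_norm_def by (intro tendsto_intros rkhs_ip u)
  have "ip S0 (ksec k x) (u n) = u n x" for n
    by (subst ksec_lincomb, subst ip0_left) (auto simp: K_closed approximates_S0[OF u])
  then have b: "cmod (u n x) \<le> ip_norm S0 (ksec k x) * ip_norm S0 (u n)" for n
    using ip0_CS[OF ksec_S0 approximates_S0[OF u], of x n] by simp
  have "(\<lambda>n. cmod (u n x)) \<longlonglongrightarrow> cmod (f x)"
    using u by (simp add: approximates_def tendsto_norm)
  moreover have "(\<lambda>n. ip_norm S0 (ksec k x) * ip_norm S0 (u n)) \<longlonglongrightarrow>
      ip_norm S0 (ksec k x) * ip_norm H f"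
    by (intro tendsto_intros n)
  ultimately show ?thesis using b by (intro LIMSEQ_le) auto
qed

lemma rkhs_converges_pointwise:
  assumes "converges_in H u f"
  shows "(\<lambda>n. u n x) \<longlonglongrightarrow> f x"
proof -
  have "cmod (u n x - f x) \<le> ip_norm S0 (ksec k x) * ip_norm H (\<lambda>x. u n x - f x)" for n
    using assms by (intro rkhs_point_bound rkhs_diff) (auto simp: converges_in_def)
  moreover have "(\<lambda>n. ip_norm S0 (ksec k x) * ip_norm H (\<lambda>x. u n x - f x)) \<longlonglongrightarrow> 0"
    using assms by (intro tendsto_mult_right_zero) (simp add: converges_in_def)
  ultimately have "(\<lambda>n. u n x - f x) \<longlonglongrightarrow> 0"
    by (rule Lim_null_comparison[OF always_eventually[OF allI]])
  then show ?thesis by (simp add: LIM_zero_iff)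
qed

text \<open>In particular the closure is single valued, that is, \<open>delta_op K\<close> is
  closable.\<close>

lemma closure_delta_op_subset_Id:
  assumes "(f, g) \<in> op_closure (ell2 K) H (delta_op K)"
  shows "g = f"
proof
  fix x
  obtain u v where uv: "\<And>n. (u n, v n) \<in> delta_op K"
    and u: "converges_in (ell2 K) u f" and v: "converges_in H v g"
    using assms by (auto simp: op_closure_def)
  have "v n = u n" for n using uv[of n] by (auto simp: delta_op_def)
  then have "v = u" by (rule ext)
  then show "g x = f x"
    using ell2_converges_pointwise[OF u] rkhs_converges_pointwise[OF v] LIMSEQ_unique by blast
qed

lemma delta_closure_delta_op:
  assumes "delta x \<in> elems H"
  shows "(delta x, delta x) \<in> op_closure (ell2 K) H (delta_op K)"
proof -
  have "converges_in (ell2 K) (\<lambda>_. delta x) (delta x)"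
    by (rule converges_in_const[OF delta_in_ell2[OF K_closed(4,5)]]) (simp add: ell2_def)
  moreover have "converges_in H (\<lambda>_. delta x) (delta x)"
    by (rule converges_in_const[OF assms rkhs_ip_zero_left[OF rkhs_zero]])
  ultimately show ?thesis
    unfolding op_closure_def using delta_in_delta_op[OF K_closed(5)]
    by (auto intro!: exI[of _ "\<lambda>_. delta x"])
qed

section \<open>The adjoint and the domain of the composition\<close>

lemma adjoint_delta_op_iff:
  assumes "\<And>x. delta x \<in> elems H"
  shows "(g, h) \<in> op_adjoint (ell2 K) H (delta_op K) \<longleftrightarrow>
    g \<in> elems H \<and> h \<in> elems (ell2 K) \<and> h = (\<lambda>y. ip H (delta y) g)"
proof (intro iffI conjI)
  assume a: "(g, h) \<in> op_adjoint (ell2 K) H (delta_op K)"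
  then show "g \<in> elems H" "h \<in> elems (ell2 K)"
    by (auto simp: op_adjoint_def)
  have "ip H (delta y) g = ip (ell2 K) (delta y) h" for y
    using a delta_in_delta_op[OF K_closed(5), of y] by (auto simp: op_adjoint_def)
  \<comment> \<open>Pairing with \<open>delta y\<close> in \<open>ell2 K\<close> picks out the value
    at \<open>y\<close>, so \<open>h\<close> is determined by \<open>g\<close>.\<close>
  then have "ip H (delta y) g = h y" for y
    using ell2_ip_lincomb_delta[of "{y}" K "\<lambda>_. 1" h] by (simp flip: delta_eq_lincomb)
  then show "h = (\<lambda>y. ip H (delta y) g)" by simp
next
  assume a: "g \<in> elems H \<and> h \<in> elems (ell2 K) \<and> h = (\<lambda>y. ip H (delta y) g)"
  \<comment> \<open>Both sides are conjugate linear in the first argument, so agreement on each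
    \<open>delta y\<close> extends to the span.\<close>
  then have "ip H (lincomb c F delta) g = ip (ell2 K) (lincomb c F delta) h"
    if "finite F" "c ` F \<subseteq> K" for c F
    using rkhs_ip_lincomb_left[OF that, of delta g] assms ell2_ip_lincomb_delta[OF that(1)] by simp
  then show "(g, h) \<in> op_adjoint (ell2 K) H (delta_op K)"
    using a unfolding op_adjoint_def delta_op_def by blast
qed

text \<open>Conjugation preserves \<open>K\<close> and the modulus. This reconciles the order of
  arguments produced by the adjoint with the order in the summability condition.\<close>

lemma ell2_cnj_iff: "(\<lambda>y. cnj (f y)) \<in> elems (ell2 K) \<longleftrightarrow> f \<in> elems (ell2 K)"
proof -
  have "cnj z \<in> K \<longleftrightarrow> z \<in> K" for z using K_closed(3)[of z] K_closed(3)[of "cnj z"] by auto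
  then show ?thesis by (simp add: ell2_elems_iff image_subset_iff)
qed

lemma delta_in_domain_iff:
  assumes "\<And>x. delta x \<in> elems H"
  shows "delta x \<in> Domain (op_closure (ell2 K) H (delta_op K) O op_adjoint (ell2 K) H (delta_op K))
    \<longleftrightarrow> (\<lambda>y. ip H (delta x) (delta y)) \<in> elems (ell2 K)"
proof -
  have "delta x \<in> Domain (op_closure (ell2 K) H (delta_op K) O op_adjoint (ell2 K) H (delta_op K))
      \<longleftrightarrow> (\<exists>h. (delta x, h) \<in> op_adjoint (ell2 K) H (delta_op K))"
    \<comment> \<open>The intermediate element of the composition can only be
      \<open>delta x\<close>, and it does occur because \<open>delta x\<close> lies in
      \<open>H\<close>.\<close>
    using closure_delta_op_subset_Id delta_closure_delta_op[OF assms] by blast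
  also have "\<dots> \<longleftrightarrow> (\<lambda>y. ip H (delta y) (delta x)) \<in> elems (ell2 K)"
    unfolding adjoint_delta_op_iff[OF assms] using assms by auto
  also have "(\<lambda>y. ip H (delta y) (delta x)) = (\<lambda>y. cnj (ip H (delta x) (delta y)))"
    using rkhs_ip_cnj[OF assms assms] by blast
  finally show ?thesis unfolding ell2_cnj_iff .
qed

end

theorem theorem4p10:
  fixes K :: "complex set" and k :: "'v \<Rightarrow> 'v \<Rightarrow> complex"
  assumes scalars: "K = \<real> \<or> K = UNIV"
    and V: "countable (UNIV :: 'v set)" "infinite (UNIV :: 'v set)"
    and k: "\<And>x y. k x y \<in> K" "pos_def_kernel k"
    and delta: "\<And>x. delta x \<in> elems (rkhs K k)"
  shows "(\<forall>x. delta x \<in> Domain (op_closure (ell2 K) (rkhs K k) (delta_op K) O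
                               op_adjoint (ell2 K) (rkhs K k) (delta_op K)))
     \<longleftrightarrow> (\<forall>x. (\<lambda>y. ip (rkhs K k) (delta x) (delta y)) \<in> elems (ell2 K))"
proof -
  interpret pd_kernel K k by unfold_locales (use scalars k in auto)
  \<comment> \<open>The two conditions agree for each \<open>x\<close> separately.\<close>
  show ?thesis using delta_in_domain_iff[OF delta] by blast
qed

end
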